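(* Let $\tau \in \mathbb{R}$ and let $\tilde{h}_\tau(t) := \exp(-\tau(t+1))$ for $t \in [-1,1]$. For every integer $k \ge 0$, let $c_k$ denote the $k$-th Chebyshev coefficient of $\tilde{h}_\tau$, i.e. $$c_k = \frac{2}{\pi}\int_0^{\pi} \cos(k\theta)\, \exp\bigl(-\tau(\cos\theta+1)\bigr)\,\mathrm{d}\theta .$$ Then for every integer $k\ge 0$, $$c_k = (-1)^k\, d_k\, \bar{c}_k, \qquad \bar{c}_k = \frac{2\,(\tau/2)^k\, \exp(-\tau)}{k!}, \qquad d_k = \sum_{i=0}^\infty \left(\frac{\tau}{2}\right)^{2i} \frac{k!}{i!\,(k+i)!}.$$ Moreover, for every integer $k \ge 0$, $$1 \le d_k \le \min\left( \exp\left(\frac{(\tau/2)^2}{k+1}\right),\ \cosh(\tau)\right).$$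
   Context: The Chebyshev polynomials of the first kind $T_k$ are characterized by $T_k(\cos\theta)=\cos(k\theta)$. The Chebyshev series of $f:[-1,1]\to\mathbb{R}$ is $f(t) = \frac{c_0}{2} + \sum_{k\ge 1} c_k T_k(t)$, with Chebyshev coefficients $c_k = \frac{2}{\pi}\int_0^\pi \cos(k\theta) f(\cos\theta)\,\mathrm{d}\theta$. The convention $0^0=1$ is used. *)

theory Defs
  imports "HOL-Analysis.Analysis"
begin

text \<open>
  Only the values of \<open>f\<close> on \<open>[-1,1]\<close> enter. With this normalization the Chebyshev series
  has constant term \<open>cheb_coeff f 0 / 2\<close>.
\<close>
definition cheb_coeff :: "(real \<Rightarrow> real) \<Rightarrow> nat \<Rightarrow> real" where
  "cheb_coeff f k = 2 / pi * integral {0..pi} (\<lambda>\<theta>. cos (real k * \<theta>) * f (cos \<theta>))"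

definition h_tilde :: "real \<Rightarrow> real \<Rightarrow> real" where
  "h_tilde \<tau> t = exp (- \<tau> * (t + 1))"

definition c_bar :: "real \<Rightarrow> nat \<Rightarrow> real" where
  "c_bar \<tau> k = 2 * (\<tau> / 2) ^ k * exp (- \<tau>) / fact k"

definition d_term :: "real \<Rightarrow> nat \<Rightarrow> nat \<Rightarrow> real" where
  "d_term \<tau> k i = (\<tau> / 2) ^ (2 * i) * (fact k / (fact i * fact (k + i)))"

definition d_coeff :: "real \<Rightarrow> nat \<Rightarrow> real" where
  "d_coeff \<tau> k = (\<Sum>i. d_term \<tau> k i)"

end

theory Submission
  imports Defs
begin

text \<open>
  Up to the factor \<open>exp (-\<tau>)\<close>, the coefficient is the integral of \<open>exp (2 x cos t) cos (k t)\<close> over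
  \<open>[0, \<pi>]\<close> with \<open>x = -\<tau>/2\<close>. Expand the exponential and integrate termwise: since \<open>2 cos t\<close> is the sum of
  \<open>cis t\<close> and \<open>cis (-t)\<close>, the binomial theorem shows that \<open>(2 cos t)^n cos (k t)\<close> integrates to
  \<open>\<pi> (n choose (k + i))\<close> if \<open>n = k + 2i\<close> and to \<open>0\<close> for every other \<open>n\<close>. The bounds on \<open>d_coeff\<close> hold term by
  term, from \<open>(k + 1)^i k! \<le> (k + i)!\<close> for the exponential and from \<open>k! i! \<le> (k + i)!\<close> and
  \<open>(2i choose i) \<le> 4^i\<close> for the hyperbolic cosine.
\<close>

text \<open>Take real parts in the binomial expansion of
  \<open>(cis t + cis (- t)) ^ n * cis (a * t)\<close>; the \<open>j\<close>-th term has frequency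
  \<open>j - (n - j) + a\<close>.\<close>

lemma binomial_cos_sum:
  fixes a t :: real
  shows "(2 * cos t) ^ n * cos (a * t) = (\<Sum>j\<le>n. real (n choose j) * cos ((2 * real j - real n + a) * t))"
proof -
  have cis: "cis t + cis (- t) = complex_of_real (2 * cos t)"
    by (simp add: complex_eq_iff)
  have "complex_of_real ((2 * cos t) ^ n) * cis (a * t) = (cis t + cis (- t)) ^ n * cis (a * t)"
    unfolding cis by simp
  also have "\<dots> = (\<Sum>j\<le>n. of_nat (n choose j) * cis t ^ j * cis (- t) ^ (n - j) * cis (a * t))"
    unfolding binomial_ring by (simp add: sum_distrib_right)
  also have "\<dots> = (\<Sum>j\<le>n. complex_of_real (real (n choose j)) * cis ((2 * real j - real n + a) * t))"
  proof (intro sum.cong refl)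
    fix j assume "j \<in> {..n}"
    hence "cis t ^ j * cis (- t) ^ (n - j) * cis (a * t) = cis ((2 * real j - real n + a) * t)"
      by (simp only: Complex.DeMoivre cis_mult) (simp add: of_nat_diff algebra_simps)
    thus "of_nat (n choose j) * cis t ^ j * cis (- t) ^ (n - j) * cis (a * t)
        = complex_of_real (real (n choose j)) * cis ((2 * real j - real n + a) * t)"
      by (simp only: mult.assoc of_real_of_nat_eq)
  qed
  finally have "Re (complex_of_real ((2 * cos t) ^ n) * cis (a * t))
      = Re (\<Sum>j\<le>n. complex_of_real (real (n choose j)) * cis ((2 * real j - real n + a) * t))"
    by (rule arg_cong)
  thus ?thesis by (simp del: of_real_power of_real_mult)
qed

text \<open>The frequency is an integer because \<open>2 * j - n + k\<close> takes both
  signs.\<close>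

lemma has_integral_cos_int:
  "((\<lambda>t. cos (real_of_int m * t)) has_integral (if m = 0 then pi else 0)) {0..pi}"
proof (cases "m = 0")
  case True
  then show ?thesis using has_integral_const_real[of "1::real" 0 pi] by simp
next
  case False
  have "((\<lambda>t. cos (real_of_int m * t)) has_integral
      sin (real_of_int m * pi) / m - sin (real_of_int m * 0) / m) {0..pi}"
    using False
    by (intro fundamental_theorem_of_calculus)
       (auto intro!: derivative_eq_intros simp flip: has_real_derivative_iff_has_vector_derivative)
  moreover have "sin (real_of_int m * pi) = 0"
    using sin_integer_2pi sin_zero_iff_int2 by blast
  ultimately show ?thesis using False by simp
qed

lemma has_integral_cos_power:
  "((\<lambda>t. (2 * cos t) ^ n * cos (real k * t)) has_integral
     (if k \<le> n \<and> even (n + k) then pi * real (n choose ((n + k) div 2)) else 0)) {0..pi}"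
proof -
  have "((\<lambda>t. \<Sum>j\<le>n. real (n choose j) * cos (real_of_int (2 * int j - int n + int k) * t)) has_integral
     (\<Sum>j\<le>n. real (n choose j) * (if 2 * int j - int n + int k = 0 then pi else 0))) {0..pi}"
    by (intro has_integral_sum has_integral_mult_right has_integral_cos_int) auto
  hence *: "((\<lambda>t. (2 * cos t) ^ n * cos (real k * t)) has_integral
     (\<Sum>j\<le>n. real (n choose j) * (if 2 * int j - int n + int k = 0 then pi else 0))) {0..pi}"
    unfolding binomial_cos_sum by simp
  show ?thesis
  proof (cases "k \<le> n \<and> even (n + k)")
    case True
    then obtain i where i: "n = k + 2 * i"
      by (metis dvd_add_left_iff even_add le_Suc_ex evenE)
    have "(\<Sum>j\<le>n. real (n choose j) * (if 2 * int j - int n + int k = 0 then pi else 0))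
        = (\<Sum>j\<le>n. if j = i then real (n choose i) * pi else 0)"
      by (intro sum.cong refl) (auto simp: i)
    \<comment> \<open>The surviving index is \<open>i\<close>; by symmetry its binomial coefficient
      is \<open>n choose (n - i)\<close>, and \<open>n - i = k + i = (n + k) div 2\<close>.\<close>
    also have "\<dots> = pi * real (n choose ((n + k) div 2))"
      using binomial_symmetric[of i n] by (simp add: i add.commute)
    finally show ?thesis using * True by simp
  next
    case False
    \<comment> \<open>Frequency zero would mean \<open>n = k + 2 * j\<close>, which forces
      \<open>k \<le> n\<close> and equal parity.\<close>
    have "2 * int j - int n + int k \<noteq> 0" for j
      using False by presburger
    then show ?thesis using * by (simp only: False if_False mult_zero_right sum.neutral_const)
  qed
qed

text \<open>The exponential series converges uniformly on the interval by the M-test, with the terms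
  of \<open>exp (2 * \<bar>x\<bar>)\<close> as majorants, so sum and integral may be
  exchanged.\<close>

lemma sums_integral_exp_cos:
  fixes x :: real
  shows "(\<lambda>n. integral {0..pi} (\<lambda>t. x ^ n / fact n * ((2 * cos t) ^ n * cos (real k * t))))
    sums integral {0..pi} (\<lambda>t. exp (2 * x * cos t) * cos (real k * t))"
proof -
  let ?f = "\<lambda>n t. x ^ n / fact n * ((2 * cos t) ^ n * cos (real k * t))"
  have exp_sums: "(\<lambda>n. ?f n t) sums (exp (2 * x * cos t) * cos (real k * t))" for t
    using sums_mult2[OF exp_converges[of "2 * x * cos t"], of "cos (real k * t)"]
    by (simp add: power_mult_distrib divide_simps mult_ac)
  have "uniform_limit {0..pi} (\<lambda>N t. \<Sum>n<N. ?f n t) (\<lambda>t. \<Sum>n. ?f n t) sequentially"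
  proof (rule Weierstrass_m_test)
    show "norm (?f n t) \<le> (2 * \<bar>x\<bar>) ^ n / fact n" for n t
    proof -
      have "\<bar>cos t\<bar> ^ n * \<bar>cos (real k * t)\<bar> \<le> 1 * 1"
        by (intro mult_mono power_le_one) auto
      thus ?thesis
        using mult_left_mono[of "\<bar>cos t\<bar> ^ n * \<bar>cos (real k * t)\<bar>" 1 "(2 * \<bar>x\<bar>) ^ n / fact n"]
        by (simp add: abs_mult power_abs power_mult_distrib mult_ac)
    qed
    show "summable (\<lambda>n. (2 * \<bar>x\<bar>) ^ n / fact n)"
      using summable_exp[of "2 * \<bar>x\<bar>"] by (simp add: field_simps)
  qed
  hence lim: "uniform_limit {0..pi} (\<lambda>N t. \<Sum>n<N. ?f n t) (\<lambda>t. exp (2 * x * cos t) * cos (real k * t)) sequentially"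
    using exp_sums[THEN sums_unique] by simp
  have int: "?f n integrable_on {0..pi}" for n
    by (intro integrable_continuous_real continuous_intros) auto
  obtain I J where I: "\<And>N. ((\<lambda>t. \<Sum>n<N. ?f n t) has_integral I N) {0..pi}"
      and J: "((\<lambda>t. exp (2 * x * cos t) * cos (real k * t)) has_integral J) {0..pi}" "I \<longlonglongrightarrow> J"
    by (rule uniform_limit_integral[OF lim])
       (auto intro!: continuous_intros)
  have "I N = (\<Sum>n<N. integral {0..pi} (?f n))" for N
    using integral_unique[OF I[of N]] integral_sum[of "{..<N}" ?f, OF _ int] by simp
  hence "I = (\<lambda>N. \<Sum>n<N. integral {0..pi} (?f n))" by blast
  thus ?thesis using J by (simp add: sums_def integral_unique)
qed

text \<open>The sum is \<open>pi\<close> times the modified Bessel function of the first kind of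
  order \<open>k\<close> at \<open>2 * x\<close>. Only the indices \<open>n = k + 2 * i\<close>
  contribute to the termwise integrals.\<close>

lemma bessel_integral_sums:
  fixes x :: real
  shows "(\<lambda>i. pi * x ^ (k + 2 * i) / (fact i * fact (k + i)))
    sums integral {0..pi} (\<lambda>t. exp (2 * x * cos t) * cos (real k * t))"
proof -
  let ?g = "\<lambda>i. k + 2 * i"
  let ?F = "\<lambda>n. integral {0..pi} (\<lambda>t. x ^ n / fact n * ((2 * cos t) ^ n * cos (real k * t)))"
  have F: "?F n = x ^ n / fact n *
      (if k \<le> n \<and> even (n + k) then pi * real (n choose ((n + k) div 2)) else 0)" for n
    by (intro integral_unique has_integral_mult_right has_integral_cos_power)
  have "?F n = 0" if "n \<notin> range ?g" for n
  proof -
    have "\<not> (k \<le> n \<and> even (n + k))"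
      using that by (metis dvd_add_left_iff even_add le_Suc_ex evenE rangeI)
    thus ?thesis unfolding F by (simp only: if_False mult_zero_right)
  qed
  hence "(\<lambda>i. ?F (?g i)) sums integral {0..pi} (\<lambda>t. exp (2 * x * cos t) * cos (real k * t))"
    using sums_integral_exp_cos[of x k]
    by (subst sums_mono_reindex) (auto simp: strict_mono_def)
  moreover have "?F (?g i) = pi * x ^ (k + 2 * i) / (fact i * fact (k + i))" for i
  proof -
    have "(k + 2 * i + k) div 2 = k + i" by simp
    moreover have "real (k + 2 * i choose (k + i)) = fact (k + 2 * i) / (fact (k + i) * fact i)"
      by (subst binomial_fact) auto
    ultimately show ?thesis unfolding F by (simp add: mult_ac)
  qed
  ultimately show ?thesis by simp
qed

lemma d_term_nonneg: "0 \<le> d_term \<tau> k i"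
  by (simp add: d_term_def)

text \<open>The quotient of the factorials is a product of \<open>i\<close> factors, each at least
  \<open>k + 1\<close>.\<close>

lemma power_times_fact_le: "Suc k ^ i * fact k \<le> (fact (k + i) :: nat)"
proof (induction i)
  case (Suc i)
  have "Suc k * (Suc k ^ i * fact k) \<le> Suc (k + i) * fact (k + i)"
    by (intro mult_mono Suc) auto
  thus ?case by (simp add: mult_ac)
qed simp

text \<open>Besides giving the exponential bound, this provides the majorant for
  \<open>summable_d_term\<close>.\<close>

lemma d_term_le_exp_term:
  "d_term \<tau> k i \<le> ((\<tau> / 2)\<^sup>2 / (real k + 1)) ^ i / fact i"
proof -
  have "real (Suc k ^ i * fact k) \<le> real (fact (k + i))"
    using power_times_fact_le[of k i] of_nat_le_iff by blast
  hence "fact k / fact (k + i) \<le> 1 / (real k + 1) ^ i"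
    by (simp add: field_simps)
  hence "((\<tau> / 2)\<^sup>2) ^ i / fact i * (fact k / fact (k + i)) \<le> ((\<tau> / 2)\<^sup>2) ^ i / fact i * (1 / (real k + 1) ^ i)"
    by (intro mult_left_mono) auto
  moreover have "d_term \<tau> k i = ((\<tau> / 2)\<^sup>2) ^ i / fact i * (fact k / fact (k + i))"
    by (simp add: d_term_def power_mult)
  ultimately show ?thesis by (simp only: power_divide[of "(\<tau> / 2)\<^sup>2"] times_divide_times_eq divide_divide_eq_left
        mult_1_right mult.commute)
qed

text \<open>The first estimate reduces to the case \<open>k = 0\<close>; in the second, the power
  \<open>2 ^ (2 * i)\<close> bounding the central binomial coefficient cancels the denominator of
  \<open>(\<tau> / 2) ^ (2 * i)\<close>.\<close>

lemma d_term_le_cosh_term: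
  "d_term \<tau> k i \<le> \<tau> ^ (2 * i) / fact (2 * i)"
proof -
  have "fact k * fact i \<le> (fact (k + i) :: nat)"
    by (rule dvd_imp_le[OF fact_fact_dvd_fact]) simp
  hence k: "fact k * fact i \<le> (fact (k + i) :: real)"
    by (metis of_nat_fact of_nat_le_iff of_nat_mult)
  have "2 * i choose i \<le> 2 ^ (2 * i)"
    by (rule binomial_le_pow2)
  hence "real (2 * i choose i) \<le> 2 ^ (2 * i)"
    by (metis of_nat_le_iff of_nat_numeral of_nat_power)
  moreover have "real (2 * i choose i) = fact (2 * i) / (fact i * fact i)"
    by (subst binomial_fact) (auto simp: mult_2)
  ultimately have c: "fact (2 * i) \<le> 2 ^ (2 * i) * (fact i * fact i :: real)"
    by (simp add: divide_le_eq)
  have "fact k / (fact i * fact (k + i)) \<le> 1 / (fact i * fact i :: real)"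
    using k by (simp add: field_simps)
  also have "\<dots> \<le> 2 ^ (2 * i) / fact (2 * i)"
    using c by (simp add: field_simps)
  finally have "(\<tau> / 2) ^ (2 * i) * (fact k / (fact i * fact (k + i))) \<le> (\<tau> / 2) ^ (2 * i) * (2 ^ (2 * i) / fact (2 * i))"
    by (intro mult_left_mono) auto
  thus ?thesis by (simp add: d_term_def power_divide)
qed

lemma summable_d_term: "summable (d_term \<tau> k)"
proof (rule summable_comparison_test')
  show "summable (\<lambda>i. ((\<tau> / 2)\<^sup>2 / (real k + 1)) ^ i / fact i)"
    using summable_exp[of "(\<tau> / 2)\<^sup>2 / (real k + 1)"] by (simp add: field_simps)
  show "norm (d_term \<tau> k i) \<le> ((\<tau> / 2)\<^sup>2 / (real k + 1)) ^ i / fact i" for i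
    using d_term_le_exp_term[of \<tau> k i] d_term_nonneg[of \<tau> k i] by simp
qed

text \<open>The term at \<open>i = 0\<close> equals 1, and the others are nonnegative because only
  even powers of \<open>\<tau>\<close> occur.\<close>

lemma d_coeff_ge_1: "1 \<le> d_coeff \<tau> k"
  using sum_le_suminf[OF summable_d_term, of "{0}" \<tau> k] d_term_nonneg
  by (simp add: d_coeff_def d_term_def[of _ _ 0])

lemma d_coeff_le_exp: "d_coeff \<tau> k \<le> exp ((\<tau> / 2)\<^sup>2 / (real k + 1))"
proof (unfold d_coeff_def, rule sums_le)
  show "d_term \<tau> k sums (\<Sum>i. d_term \<tau> k i)"
    using summable_d_term by (rule summable_sums)
  show "(\<lambda>i. ((\<tau> / 2)\<^sup>2 / (real k + 1)) ^ i / fact i) sums exp ((\<tau> / 2)\<^sup>2 / (real k + 1))"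
    using exp_converges[of "(\<tau> / 2)\<^sup>2 / (real k + 1)"] by (simp add: field_simps)
qed (rule d_term_le_exp_term)

lemma d_coeff_le_cosh: "d_coeff \<tau> k \<le> cosh \<tau>"
proof (unfold d_coeff_def, rule sums_le)
  show "d_term \<tau> k sums (\<Sum>i. d_term \<tau> k i)"
    using summable_d_term by (rule summable_sums)
  \<comment> \<open>The library series for \<open>cosh\<close> runs over all exponents with zeros at
    the odd ones; reindexing by doubling drops them.\<close>
  show "(\<lambda>i. \<tau> ^ (2 * i) / fact (2 * i)) sums cosh \<tau>"
    using cosh_converges[of \<tau>]
    by (subst (asm) sums_mono_reindex[of "\<lambda>i. 2 * i", symmetric])
       (auto simp: strict_mono_def divide_inverse mult.commute elim!: evenE)
qed (rule d_term_le_cosh_term)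

lemma cheb_coeff_h_tilde:
  "cheb_coeff (h_tilde \<tau>) k = (-1) ^ k * d_coeff \<tau> k * c_bar \<tau> k"
proof -
  \<comment> \<open>Chosen so that \<open>2 * ?x * cos t\<close> is \<open>- \<tau> * cos t\<close>.
    The sign survives only in \<open>?x ^ k\<close>, which yields \<open>(-1) ^ k\<close>; the shift
    by 1 in \<open>h_tilde\<close> yields the factor \<open>exp (- \<tau>)\<close> of
    \<open>c_bar\<close>.\<close>
  let ?x = "- (\<tau> / 2)"
  let ?I = "integral {0..pi} (\<lambda>t. exp (2 * ?x * cos t) * cos (real k * t))"
  have "(\<lambda>i. pi * ?x ^ k / fact k * d_term \<tau> k i) sums (pi * ?x ^ k / fact k * d_coeff \<tau> k)"
    unfolding d_coeff_def by (intro sums_mult summable_sums summable_d_term)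
  moreover have "pi * ?x ^ k / fact k * d_term \<tau> k i = pi * ?x ^ (k + 2 * i) / (fact i * fact (k + i))" for i
    by (simp add: d_term_def power_add)
  ultimately have I: "?I = pi * ?x ^ k / fact k * d_coeff \<tau> k"
    using sums_unique2[OF bessel_integral_sums[of ?x k]] by simp
  have "integral {0..pi} (\<lambda>t. cos (real k * t) * h_tilde \<tau> (cos t))
      = integral {0..pi} (\<lambda>t. exp (- \<tau>) * (exp (2 * ?x * cos t) * cos (real k * t)))"
    by (intro integral_cong) (simp add: h_tilde_def algebra_simps exp_diff exp_minus divide_simps)
  also have "\<dots> = exp (- \<tau>) * ?I"
    by (rule integral_mult_right)
  finally show ?thesis
    unfolding cheb_coeff_def c_bar_def I
    by (simp add: power_minus[of "\<tau> / 2"])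
qed

text \<open>Summability is part of the claim because \<open>d_coeff\<close> is an infinite sum whose
  value is meaningful only if the series converges.\<close>

theorem mainTheorem1:
  fixes \<tau> :: real and k :: nat
  shows "summable (d_term \<tau> k)
    \<and> cheb_coeff (h_tilde \<tau>) k = (-1) ^ k * d_coeff \<tau> k * c_bar \<tau> k
    \<and> 1 \<le> d_coeff \<tau> k
    \<and> d_coeff \<tau> k \<le> min (exp ((\<tau> / 2)\<^sup>2 / (real k + 1))) (cosh \<tau>)"
  by (simp add: summable_d_term cheb_coeff_h_tilde d_coeff_ge_1 d_coeff_le_exp d_coeff_le_cosh)

end
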